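(* For any positive integer $k$ there exists a finite tree $T_{(k)}$ such that $\tau(T_{(k)})-\gamma_t(T_{(k)})=k$.
   Context: A vertex cover of a graph $G=(V,E)$ is a set $X\subseteq V$ such that each edge is incident to at least one vertex of $X$; $\tau(G)$ is the minimum cardinality of a vertex cover of $G$. A total dominating set of $G$ is a dominating set $D\subseteq V$ such that the subgraph induced by $D$ has no isolated vertices (equivalently, every vertex of $G$ has a neighbor in $D$); $\gamma_t(G)$ is the minimum cardinality of a total dominating set of $G$ (defined for graphs without isolated vertices). *)

theory Defs
  imports "Graph_Theory.Graph_Theory"
begin

text \<open>
  A finite simple undirected graph is a \<^locale>\<open>graph\<close>: a finite symmetric digraph without
  loops and multi-arcs, in which an edge is a pair of opposite arcs. The library constant
  \<^const>\<open>tree\<close> is not the undirected notion: on symmetric digraphs it counts a closed walk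
  \<open>u, v, u\<close> along a single edge as a \<^const>\<open>pre_digraph.cycle\<close>. The cycles of an undirected
  graph are those with at least three arcs.
\<close>

definition undirected_tree :: "('a, 'b) pre_digraph \<Rightarrow> bool" where
  "undirected_tree G \<longleftrightarrow>
     graph G \<and> connected G \<and> \<not> (\<exists>p. pre_digraph.cycle G p \<and> length p \<ge> 3)"

definition vertex_cover :: "('a, 'b) pre_digraph \<Rightarrow> 'a set \<Rightarrow> bool" where
  "vertex_cover G X \<longleftrightarrow>
     X \<subseteq> verts G \<and> (\<forall>e \<in> arcs G. tail G e \<in> X \<or> head G e \<in> X)"

definition vertex_cover_number :: "('a, 'b) pre_digraph \<Rightarrow> nat" where
  "vertex_cover_number G = (LEAST n. \<exists>X. vertex_cover G X \<and> card X = n)"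

definition no_isolated_vertices :: "('a, 'b) pre_digraph \<Rightarrow> bool" where
  "no_isolated_vertices G \<longleftrightarrow> (\<forall>v \<in> verts G. \<exists>w. v \<rightarrow>\<^bsub>G\<^esub> w)"

definition dominating_set :: "('a, 'b) pre_digraph \<Rightarrow> 'a set \<Rightarrow> bool" where
  "dominating_set G D \<longleftrightarrow>
     D \<subseteq> verts G \<and> (\<forall>v \<in> verts G - D. \<exists>w \<in> D. v \<rightarrow>\<^bsub>G\<^esub> w)"

definition total_dominating_set :: "('a, 'b) pre_digraph \<Rightarrow> 'a set \<Rightarrow> bool" where
  "total_dominating_set G D \<longleftrightarrow> dominating_set G D \<and> no_isolated_vertices (G \<restriction> D)"

text \<open>Only meaningful for graphs without isolated vertices: other graphs have no total
  dominating set.\<close>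

definition total_domination_number :: "('a, 'b) pre_digraph \<Rightarrow> nat" where
  "total_domination_number G = (LEAST n. \<exists>D. total_dominating_set G D \<and> card D = n)"

end

theory Submission
  imports Defs
begin

text \<open>
  Take \<open>k + 1\<close> double stars, each consisting of two adjacent vertices with one leaf apiece, and
  join consecutive ones by paths with two inner vertices. The \<open>2 k + 2\<close> star centres are support
  vertices, so they lie in every total dominating set, and they form one themselves. The centres
  together with the first inner vertex of each of the \<open>k\<close> joining paths form a vertex cover, and
  it is minimum because a matching pairs its members with vertices outside it.
\<close>

section \<open>Trees encoded by parent functions\<close>

definition parent_graph :: "(nat \<Rightarrow> nat) \<Rightarrow> nat \<Rightarrow> (nat, nat \<times> nat) pre_digraph" where
  "parent_graph p n =
     \<lparr> verts = {..<n},
       arcs = {(u, v). u < n \<and> v < n \<and> (0 < u \<and> v = p u \<or> 0 < v \<and> u = p v)},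
       tail = fst, head = snd \<rparr>"

lemma parent_graph_simps [simp]:
  "verts (parent_graph p n) = {..<n}"
  "tail (parent_graph p n) = fst"
  "head (parent_graph p n) = snd"
  by (simp_all add: parent_graph_def)

lemma arcs_parent_graph:
  "(u, v) \<in> arcs (parent_graph p n) \<longleftrightarrow>
     u < n \<and> v < n \<and> (0 < u \<and> v = p u \<or> 0 < v \<and> u = p v)"
  by (simp add: parent_graph_def)

lemma dominates_parent_graph:
  "u \<rightarrow>\<^bsub>parent_graph p n\<^esub> v \<longleftrightarrow>
     u < n \<and> v < n \<and> (0 < u \<and> v = p u \<or> 0 < v \<and> u = p v)"
  by (force simp: arcs_ends_def arc_to_ends_def parent_graph_def)

text \<open>A cycle is a list of arcs; indexed vertices make it possible to speak of the two cycle
  neighbours of a vertex. Injectivity starts at index 1 because the closing vertex occurs at both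
  ends.\<close>

lemma (in pre_digraph) cycle_vertex_sequence:
  assumes "cycle c"
  obtains vs where "vs 0 = vs (length c)" "inj_on vs {1..length c}"
    "\<And>i. i < length c \<Longrightarrow> \<exists>e \<in> arcs G. tail G e = vs i \<and> head G e = vs (Suc i)"
proof -
  obtain u where u: "awalk u c u" "distinct (tl (awalk_verts u c))" "c \<noteq> []"
    using assms by (auto simp: cycle_def)
  then have cas: "cas u c u" and sub: "set c \<subseteq> arcs G" by (auto simp: awalk_def)
  let ?vs = "awalk_verts u c"
  \<comment> \<open>The visited vertices are the tails followed by the last head, and also the first
    tail followed by the heads. The first form gives the tail of arc \<open>i\<close> at index
    \<open>i\<close>, the second its head at \<open>Suc i\<close>.\<close>
  have tails: "?vs = map (tail G) c @ [head G (last c)]"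
    using u(3) by (simp add: awalk_verts_conv)
  have heads: "?vs = tail G (hd c) # map (head G) c"
    using awalk_verts_conv'[OF cas] u(3) by simp
  have last: "head G (last c) = tail G (hd c)"
  proof -
    have "head G (last c) = v" if "cas u c v" "c \<noteq> []" for u v
      using that by (induction c arbitrary: u) (auto split: if_splits)
    then show ?thesis using cas u(3) by (auto simp: cas_simp)
  qed
  show ?thesis
  proof (rule that[of "\<lambda>i. ?vs ! i"])
    show "?vs ! 0 = ?vs ! length c"
      using last by (subst (2) tails) (simp add: heads nth_append)
    have "distinct (map (head G) c)" using u(2) heads by simp
    then show "inj_on (\<lambda>i. ?vs ! i) {1..length c}"
      by (auto simp: heads inj_on_def nth_eq_iff_index_eq nth_Cons distinct_conv_nth
          split: nat.splits) (metis Suc_le_lessD nth_map)+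
    fix i assume i: "i < length c"
    have "?vs ! i = tail G (c ! i)" using i by (simp add: tails nth_append)
    moreover have "?vs ! Suc i = head G (c ! i)" using i by (simp add: heads)
    ultimately show "\<exists>e \<in> arcs G. tail G e = ?vs ! i \<and> head G e = ?vs ! Suc i"
      using i sub by (metis nth_mem subsetD)
  qed
qed

text \<open>Since parents are smaller than their children, every chain of parents descends to the
  root 0, and the usual order on numbers can serve in the acyclicity proof.\<close>

locale parent_function =
  fixes p :: "nat \<Rightarrow> nat" and n :: nat
  assumes parent_less: "0 < v \<Longrightarrow> p v < v"
    and n_pos: "0 < n"
begin

abbreviation "T \<equiv> parent_graph p n"

lemma graph_T: "graph T"
proof -
  have "finite (arcs T)"
    by (rule finite_subset[of _ "{..<n} \<times> {..<n}"]) (auto simp: parent_graph_def)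
  then show ?thesis
    using parent_less[THEN less_imp_neq, THEN not_sym]
    by unfold_locales
      (auto simp: arcs_parent_graph arc_to_ends_def symmetric_def sym_def dominates_parent_graph)
qed

lemma connected_T: "connected T"
proof -
  interpret graph T by (rule graph_T)
  have root: "v \<rightarrow>\<^sup>*\<^bsub>T\<^esub> 0" if "v < n" for v
    using that
  proof (induction v rule: less_induct)
    case (less v)
    show ?case
    proof (cases "v = 0")
      case True
      then show ?thesis using n_pos by simp
    next
      case False
      then have "p v < v" using parent_less by simp
      moreover have "v \<rightarrow>\<^bsub>T\<^esub> p v"
        using False \<open>p v < v\<close> less.prems by (simp add: dominates_parent_graph)
      ultimately show ?thesis using less by (meson adj_reachable_trans less_trans)
    qed
  qed
  show ?thesis
  proof (rule connectedI)
    fix u v assume "u \<in> verts T" "v \<in> verts T"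
    then have "u \<rightarrow>\<^sup>*\<^bsub>T\<^esub> 0" "0 \<rightarrow>\<^sup>*\<^bsub>T\<^esub> v"
      using root symmetric_reachable[OF sym_arcs] by auto
    then show "u \<rightarrow>\<^sup>*\<^bsub>with_proj (mk_symmetric T)\<^esub> v"
      by (blast intro: reachable_mk_symmetricI reachable_trans)
  qed (use n_pos in auto)
qed

text \<open>Both cycle neighbours of the largest vertex of a cycle are its parent.\<close>

lemma acyclic_T:
  assumes "pre_digraph.cycle T c"
  shows "length c < 3"
proof (rule ccontr)
  assume "\<not> length c < 3"
  then have len: "3 \<le> length c" by simp
  define m where "m = length c"
  obtain vs where closed: "vs 0 = vs m" and inj: "inj_on vs {1..m}"
    and arc_ex: "\<And>i. i < m \<Longrightarrow> \<exists>e \<in> arcs T. tail T e = vs i \<and> head T e = vs (Suc i)"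
    using pre_digraph.cycle_vertex_sequence[OF assms] unfolding m_def by blast
  have arc: "(vs i, vs (Suc i)) \<in> arcs T" if "i < m" for i
    using arc_ex[OF that] by (auto simp: prod_eq_iff)
  have fin: "finite (vs ` {1..m})" and ne: "vs ` {1..m} \<noteq> {}"
    using len by (auto simp: m_def)
  from Max_in[OF fin ne] obtain i where i: "1 \<le> i" "i \<le> m" and "vs i = Max (vs ` {1..m})"
    by auto
  then have max: "vs j \<le> vs i" if "1 \<le> j" "j \<le> m" for j
    using Max_ge[OF fin] that by simp
  \<comment> \<open>The other orientation would give \<open>vs i = p v < v\<close>, against
    \<open>v \<le> vs i\<close>.\<close>
  have parent: "v = p (vs i)"
    if "(vs i, v) \<in> arcs T \<or> (v, vs i) \<in> arcs T" "v \<le> vs i" for v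
    using that parent_less[of v] parent_less[of "vs i"] by (auto simp: arcs_parent_graph)
  \<comment> \<open>The positions before and after \<open>i\<close>, wrapped around to stay in
    \<open>{1..m}\<close>, where \<open>vs\<close> is injective. They differ because the length is
    at least 3.\<close>
  define a where "a = (if i = 1 then m else i - 1)"
  define b where "b = (if i = m then 1 else Suc i)"
  have ab: "1 \<le> a" "a \<le> m" "1 \<le> b" "b \<le> m" "a \<noteq> b"
    using i len by (auto simp: a_def b_def m_def)
  have "(vs a, vs i) \<in> arcs T"
    using arc[of "i - 1"] i closed by (auto simp: a_def)
  moreover have "(vs i, vs b) \<in> arcs T"
    using arc[of i] arc[of 0] i closed by (auto simp: b_def)
  ultimately have "vs a = vs b" using parent max ab by metis
  then show False using inj ab by (auto dest: inj_onD)
qed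

lemma undirected_tree_T: "undirected_tree T"
  using graph_T connected_T acyclic_T by (force simp: undirected_tree_def)

lemma no_isolated_vertices_T:
  assumes "1 < n"
  shows "no_isolated_vertices T"
  unfolding no_isolated_vertices_def
proof
  fix v assume v: "v \<in> verts T"
  show "\<exists>w. v \<rightarrow>\<^bsub>T\<^esub> w"
  proof (cases "v = 0")
    case True
    \<comment> \<open>\<open>p 1 < 1\<close> forces \<open>p 1 = 0\<close>, so 1 is a neighbour of
      the root.\<close>
    then show ?thesis using assms parent_less[of 1] by (auto simp: dominates_parent_graph)
  next
    case False
    then have "v \<rightarrow>\<^bsub>T\<^esub> p v"
      using v parent_less[of v] by (simp add: dominates_parent_graph)
    then show ?thesis ..
  qed
qed

end

section \<open>Criteria for the two graph parameters\<close>

text \<open>Together with \<open>total_dominating_setI\<close> this trades the induced subgraph for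
  the condition that every vertex has a neighbour in \<open>D\<close>.\<close>

lemma total_dominating_set_neighbour:
  assumes "total_dominating_set G D" "v \<in> verts G"
  obtains w where "w \<in> D" "v \<rightarrow>\<^bsub>G\<^esub> w"
proof (cases "v \<in> D")
  case True
  then obtain w where "v \<rightarrow>\<^bsub>G \<restriction> D\<^esub> w"
    using assms by (auto simp: total_dominating_set_def no_isolated_vertices_def)
  then have "w \<in> D \<and> v \<rightarrow>\<^bsub>G\<^esub> w"
    by (auto simp: arcs_ends_def arc_to_ends_def)
  then show ?thesis using that by blast
next
  case False
  then show ?thesis
    using assms that by (auto simp: total_dominating_set_def dominating_set_def)
qed

lemma total_dominating_setI:
  assumes "D \<subseteq> verts G" "\<And>v. v \<in> verts G \<Longrightarrow> \<exists>w \<in> D. v \<rightarrow>\<^bsub>G\<^esub> w"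
  shows "total_dominating_set G D"
proof -
  have "\<exists>w. v \<rightarrow>\<^bsub>G \<restriction> D\<^esub> w" if v: "v \<in> D" for v
  proof -
    obtain w where "w \<in> D" "v \<rightarrow>\<^bsub>G\<^esub> w" using assms v by blast
    then have "v \<rightarrow>\<^bsub>G \<restriction> D\<^esub> w"
      using v by (force simp: arcs_ends_def arc_to_ends_def)
    then show ?thesis ..
  qed
  then show ?thesis
    using assms
    by (auto simp: total_dominating_set_def dominating_set_def no_isolated_vertices_def)
qed

lemma total_domination_number_eq:
  assumes "total_dominating_set G D" "\<And>D'. total_dominating_set G D' \<Longrightarrow> card D \<le> card D'"
  shows "total_domination_number G = card D"
  unfolding total_domination_number_def using assms by (intro Least_equality) auto

lemma vertex_cover_number_eq:
  assumes "vertex_cover G C" "\<And>X. vertex_cover G X \<Longrightarrow> card C \<le> card X"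
  shows "vertex_cover_number G = card C"
  unfolding vertex_cover_number_def using assms by (intro Least_equality) auto

text \<open>The edges from \<open>v\<close> to \<open>mate v\<close> form a matching, and a cover
  contains an end of each; \<open>?f\<close> selects one.\<close>

lemma card_le_vertex_cover:
  assumes X: "vertex_cover G X" and fin: "finite (verts G)"
    and inj: "inj_on mate C"
    and out: "\<And>v. v \<in> C \<Longrightarrow> mate v \<notin> C"
    and adj: "\<And>v. v \<in> C \<Longrightarrow> v \<rightarrow>\<^bsub>G\<^esub> mate v"
  shows "card C \<le> card X"
proof (rule card_inj_on_le)
  let ?f = "\<lambda>v. if v \<in> X then v else mate v"
  show "inj_on ?f C" using inj out by (auto simp: inj_on_def)
  show "?f ` C \<subseteq> X"
  proof
    fix y assume "y \<in> ?f ` C"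
    then obtain v where v: "v \<in> C" "y = ?f v" by blast
    then obtain e where "e \<in> arcs G" "tail G e = v" "head G e = mate v"
      using adj by blast
    then show "y \<in> X" using v X by (auto simp: vertex_cover_def)
  qed
  show "finite X" using X fin by (auto simp: vertex_cover_def intro: finite_subset)
qed

section \<open>The chain of double stars\<close>

text \<open>
  Block \<open>q\<close> has the centres \<open>6 q\<close> and \<open>6 q + 1\<close> with the respective leaves \<open>6 q + 2\<close> and
  \<open>6 q + 3\<close>. The path to the next block runs from \<open>6 q + 1\<close> through \<open>6 q + 4\<close> and \<open>6 q + 5\<close> to
  \<open>6 q + 6\<close>.
\<close>

definition double_star_parent :: "nat \<Rightarrow> nat" where
  "double_star_parent v =
     (if v mod 6 \<in> {2, 3} then v - 2 else if v mod 6 = 4 then v - 3 else v - 1)"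

text \<open>The blocks are numbered 0 to \<open>k\<close>; the last one ends with its leaf
  \<open>6 * k + 3\<close> and has no path leaving it.\<close>

definition double_star_tree :: "nat \<Rightarrow> (nat, nat \<times> nat) pre_digraph" where
  "double_star_tree k = parent_graph double_star_parent (6 * k + 4)"

definition centres :: "nat \<Rightarrow> nat set" where
  "centres k = {v. v < 6 * k + 4 \<and> v mod 6 \<in> {0, 1}}"

definition connectors :: "nat \<Rightarrow> nat set" where
  "connectors k = {v. v < 6 * k + 4 \<and> v mod 6 = 4}"

lemma residue_mod_6_cases:
  fixes v :: nat
  obtains q where "v = 6 * q" | q where "v = 6 * q + 1" | q where "v = 6 * q + 2"
    | q where "v = 6 * q + 3" | q where "v = 6 * q + 4" | q where "v = 6 * q + 5"
proof -
  have "v mod 6 < 6" by simp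
  then consider "v mod 6 = 0" | "v mod 6 = 1" | "v mod 6 = 2" | "v mod 6 = 3" | "v mod 6 = 4"
    | "v mod 6 = 5"
    by linarith
  then show ?thesis by cases (metis that add_0_right mult_div_mod_eq)+
qed

lemma parent_function_double_star: "parent_function double_star_parent (6 * k + 4)"
  by unfold_locales (auto simp: double_star_parent_def)

lemma verts_double_star_tree [simp]: "verts (double_star_tree k) = {..<6 * k + 4}"
  by (simp add: double_star_tree_def)

lemma card_centres_Un_connectors: "card (centres k \<union> connectors k) = card (centres k) + k"
proof -
  have "connectors k = (\<lambda>q. 6 * q + 4) ` {..<k}"
  proof (intro equalityI subsetI)
    fix v assume "v \<in> connectors k"
    then have "v < 6 * k + 4" "v mod 6 = 4" by (simp_all add: connectors_def)
    then have "v = 6 * (v div 6) + 4" "v div 6 < k"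
      using div_mult_mod_eq[of v 6] by linarith+
    then show "v \<in> (\<lambda>q. 6 * q + 4) ` {..<k}" by blast
  qed (auto simp: connectors_def mod_simps)
  then have "card (connectors k) = k" by (simp add: card_image inj_on_def)
  moreover have "card (centres k \<union> connectors k) = card (centres k) + card (connectors k)"
    by (rule card_Un_disjoint) (auto simp: centres_def connectors_def)
  ultimately show ?thesis by simp
qed

lemma vertex_cover_number_double_star_tree:
  "vertex_cover_number (double_star_tree k) = card (centres k \<union> connectors k)"
proof (rule vertex_cover_number_eq)
  let ?C = "centres k \<union> connectors k"
  have "u \<in> ?C \<or> v \<in> ?C" if "(u, v) \<in> arcs (double_star_tree k)" for u v
  proof -
    \<comment> \<open>Every edge joins a nonroot vertex to its parent, so it suffices to check these
      pairs by residue.\<close>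
    have child: "w \<in> ?C \<or> double_star_parent w \<in> ?C" if "0 < w" "w < 6 * k + 4" for w
      using that by (cases w rule: residue_mod_6_cases)
        (auto simp: double_star_parent_def centres_def connectors_def mod_Suc)
    show ?thesis
      using that child by (auto simp: double_star_tree_def arcs_parent_graph)
  qed
  then show "vertex_cover (double_star_tree k) ?C"
    by (auto simp: vertex_cover_def centres_def connectors_def double_star_tree_def)
  \<comment> \<open>A centre is matched with its leaf, the first inner vertex of a path with the
    second. In both cases the mate is a child, so \<open>double_star_parent\<close> is a left
    inverse of \<open>mate\<close>, which yields injectivity.\<close>
  define mate :: "nat \<Rightarrow> nat" where "mate v = (if v mod 6 = 4 then v + 1 else v + 2)" for v
  have parent_mate: "double_star_parent (mate v) = v" if "v \<in> ?C" for v
    using that by (cases v rule: residue_mod_6_cases)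
      (auto simp: double_star_parent_def mate_def centres_def connectors_def mod_Suc)
  have mate_out: "mate v \<notin> ?C" if "v \<in> ?C" for v
    using that by (cases v rule: residue_mod_6_cases)
      (auto simp: mate_def centres_def connectors_def mod_Suc)
  have mate_less: "0 < mate v \<and> mate v < 6 * k + 4" if "v \<in> ?C" for v
    using that by (cases v rule: residue_mod_6_cases;
        simp add: mate_def centres_def connectors_def mod_Suc; presburger)
  fix X assume "vertex_cover (double_star_tree k) X"
  then show "card ?C \<le> card X"
  proof (rule card_le_vertex_cover)
    show "inj_on mate ?C" using parent_mate by (metis inj_on_def)
    show "v \<rightarrow>\<^bsub>double_star_tree k\<^esub> mate v" if "v \<in> ?C" for v
      using parent_mate[OF that] mate_less[OF that] that
      by (auto simp: double_star_tree_def dominates_parent_graph centres_def connectors_def)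
  qed (use mate_out in auto)
qed

lemma total_domination_number_double_star_tree:
  "total_domination_number (double_star_tree k) = card (centres k)"
proof (rule total_domination_number_eq)
  let ?p = double_star_parent
  show "total_dominating_set (double_star_tree k) (centres k)"
  proof (rule total_dominating_setI)
    fix v assume "v \<in> verts (double_star_tree k)"
    then have v: "v < 6 * k + 4" by simp
    \<comment> \<open>The successor of a vertex with residue 0 is the other centre of its block;
      with residue 5, the first centre of the next block. All other vertices have a centre as
      parent.\<close>
    show "\<exists>w \<in> centres k. v \<rightarrow>\<^bsub>double_star_tree k\<^esub> w"
    proof (cases "v mod 6 \<in> {0, 5}")
      case True
      then have "Suc v \<in> centres k \<and> ?p (Suc v) = v \<and> Suc v < 6 * k + 4"
        using v by (cases v rule: residue_mod_6_cases;
            auto simp: double_star_parent_def centres_def mod_Suc; presburger)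
      moreover from this have "v \<rightarrow>\<^bsub>double_star_tree k\<^esub> Suc v"
        using v by (simp add: double_star_tree_def dominates_parent_graph)
      ultimately show ?thesis by blast
    next
      case False
      then have "?p v \<in> centres k \<and> 0 < v \<and> ?p v < 6 * k + 4"
        using v by (cases v rule: residue_mod_6_cases;
            auto simp: double_star_parent_def centres_def mod_Suc; presburger)
      then show ?thesis using v by (auto simp: double_star_tree_def dominates_parent_graph)
    qed
  qed (auto simp: centres_def)
  fix D assume D: "total_dominating_set (double_star_tree k) D"
  have "centres k \<subseteq> D"
  proof
    fix v assume "v \<in> centres k"
    then have "v + 2 < 6 * k + 4 \<and> ?p (v + 2) = v \<and> (v + 2) mod 6 \<in> {2, 3}"
      by (cases v rule: residue_mod_6_cases;
          simp add: double_star_parent_def centres_def mod_Suc; presburger)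
    then have leaf: "v + 2 < 6 * k + 4" "?p (v + 2) = v" "(v + 2) mod 6 \<in> {2, 3}"
      by simp_all
    obtain w where w: "w \<in> D" "(v + 2) \<rightarrow>\<^bsub>double_star_tree k\<^esub> w"
      using total_dominating_set_neighbour[OF D, of "v + 2"] leaf(1)
      unfolding verts_double_star_tree lessThan_iff by blast
    \<comment> \<open>No parent has the residue of a leaf, so the leaf \<open>v + 2\<close> has no
      children and \<open>v\<close> is its only neighbour.\<close>
    have "?p w mod 6 \<notin> {2, 3}" if "0 < w"
    proof (cases w rule: residue_mod_6_cases)
      case (1 q)
      \<comment> \<open>The parent of \<open>6 * q\<close> lies in the preceding block, hence the
        shift of \<open>q\<close>.\<close>
      then obtain r where "q = Suc r" using \<open>0 < w\<close> by (cases q) auto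
      then have "?p w = 6 * r + 5" using 1 by (simp add: double_star_parent_def)
      then show ?thesis by (simp add: mod_Suc)
    qed (simp_all add: double_star_parent_def mod_Suc)
    then have "?p w \<noteq> v + 2" if "0 < w"
      using leaf(3) that by metis
    then have "w = v"
      using w(2) leaf(2) by (auto simp: double_star_tree_def dominates_parent_graph)
    then show "v \<in> D" using w(1) by simp
  qed
  moreover have "finite D"
    using D by (auto simp: total_dominating_set_def dominating_set_def intro: finite_subset)
  ultimately show "card (centres k) \<le> card D" by (simp add: card_mono)
qed

theorem proposition1:
  fixes k :: nat
  assumes "k > 0"
  shows "\<exists>T :: (nat, nat \<times> nat) pre_digraph.
           undirected_tree T \<and> no_isolated_vertices T \<and>
           int (vertex_cover_number T) - int (total_domination_number T) = int k"
proof (intro exI conjI)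
  interpret parent_function double_star_parent "6 * k + 4"
    by (rule parent_function_double_star)
  show "undirected_tree (double_star_tree k)"
    using undirected_tree_T by (simp add: double_star_tree_def)
  show "no_isolated_vertices (double_star_tree k)"
    using no_isolated_vertices_T by (simp add: double_star_tree_def)
  show "int (vertex_cover_number (double_star_tree k)) -
      int (total_domination_number (double_star_tree k)) = int k"
    by (simp add: vertex_cover_number_double_star_tree
        total_domination_number_double_star_tree card_centres_Un_connectors)
qed

end
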